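(* Let $\mathbf K_m$ be any symmetric positive definite permeability field on $\Omega$, let $\mathcal T_h$ be any triangulation of $\Omega$ (not required to be fitted to the barrier $\Gamma$), let $R>0$, and let $\ell_T>0$ for every cut cell $T\in\mathcal T_h^\Gamma$. For each cut cell $T\in\mathcal T_h^{\Gamma}$ with lone vertex $\gamma=\gamma(T)$, let $$\widetilde K_T = K_T-\frac{(K_T\mathbf e_\gamma)(K_T\mathbf e_\gamma)^{\mathsf T}}{(K_T)_{\gamma\gamma}+\ell_T/R}\in\mathbb R^{3\times 3}.$$ Then $\widetilde K_T$ is symmetric and positive semidefinite, and its kernel is exactly the set of multiples of $\mathbf 1=(1,1,1)^{\mathsf T}$. Consequently, the global stiffness matrix on the free nodes obtained by assembling $\widetilde K_T$ for every $T\in\mathcal T_h^\Gamma$ and $K_T$ for every $T\in\mathcal T_h\setminus\mathcal T_h^\Gamma$ is symmetric positive definite whenever the standard $P^1$ finite element global stiffness matrix on the free nodes (obtained by assembling $K_T$ for every $T\in\mathcal T_h$) is symmetric positive definite.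
   Context: Setting. $\Omega\subset\mathbb R^2$ is the computational domain, with boundary $\partial\Omega=\Gamma_D\cup\Gamma_N$, where Dirichlet conditions are imposed on $\Gamma_D$ and $\Gamma_N=\partial\Omega\setminus\Gamma_D$. The matrix permeability $\mathbf K_m(x)\in\mathbb R^{2\times2}$ is symmetric positive definite for each $x\in\Omega$; it may be heterogeneous (depend on $x$) and anisotropic, and its entries are integrable on each cell so that the integrals below are defined. $\Gamma\subset\Omega$ is a (piecewise) straight barrier with resistance $R>0$. Mesh and local matrices. $\mathcal T_h$ is a triangulation of $\Omega$ into (nondegenerate) triangles. The finite element space $V_h\subset H^1(\Omega)$ consists of continuous piecewise linear functions on $\mathcal T_h$. For a cell $T\in\mathcal T_h$ with local vertices $1,2,3$ and nodal hat functions $\phi_1,\phi_2,\phi_3$ (the affine functions on $T$ equal to $1$ at one vertex and $0$ at the other two), the local stiffness matrix is $$(K_T)_{\mu\nu}=\int_T \mathbf K_m\nabla\phi_\mu\cdot\nabla\phi_\nu\,d\mathbf x,\qquad \mu,\nu=1,2,3.$$ Cut cells. A cell $T$ is called cut if $\Gamma$ crosses its interior, and $\mathcal T_h^\Gamma\subset\mathcal T_h$ denotes the set of cut cells. In each cut cell, $\Gamma\cap T$ is a single chord of length $\ell_T=|\Gamma\cap T|$, entering and leaving through two different edges, so that exactly one vertex of $T$, called the lone vertex $\gamma=\gamma(T)\in\{1,2,3\}$, is separated by the chord from the other two vertices. $\mathbf e_\gamma$ is the $\gamma$-th coordinate vector of $\mathbb R^3$. Global assembly. The free nodes are the mesh vertices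 not on the Dirichlet boundary $\Gamma_D$. Assembling a family of local $3\times3$ matrices $(M_T)_{T\in\mathcal T_h}$ means forming the global matrix $M$ on all mesh nodes with $\mathbf u^{\mathsf T}M\mathbf w=\sum_{T\in\mathcal T_h}\mathbf u_T^{\mathsf T}M_T\mathbf w_T$, where $\mathbf u_T\in\mathbb R^3$ is the restriction of the global nodal vector $\mathbf u$ to the vertices of $T$; the global stiffness matrix on the free nodes is the principal submatrix of $M$ indexed by the free nodes. *)

theory Defs
  imports "HOL-Analysis.Analysis"
begin

definition symmetric_matrix :: "real^'n^'n \<Rightarrow> bool" where
  "symmetric_matrix A \<longleftrightarrow> transpose A = A"

definition pos_semidef :: "real^'n^'n \<Rightarrow> bool" where
  "pos_semidef A \<longleftrightarrow> (\<forall>x. 0 \<le> x \<bullet> (A *v x))"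

definition pos_def :: "real^'n^'n \<Rightarrow> bool" where
  "pos_def A \<longleftrightarrow> (\<forall>x. x \<noteq> 0 \<longrightarrow> 0 < x \<bullet> (A *v x))"

text \<open>
  Global matrices have their rows and columns indexed by points of the plane (the mesh nodes).
  The principal submatrix indexed by a finite set \<open>I\<close> of nodes is represented by restricting all
  indices to \<open>I\<close>.
\<close>

definition sym_pos_def_on :: "'i set \<Rightarrow> ('i \<Rightarrow> 'i \<Rightarrow> real) \<Rightarrow> bool" where
  "sym_pos_def_on I M \<longleftrightarrow>
     (\<forall>i\<in>I. \<forall>j\<in>I. M i j = M j i) \<and>
     (\<forall>u. (\<exists>i\<in>I. u i \<noteq> 0) \<longrightarrow> 0 < (\<Sum>i\<in>I. \<Sum>j\<in>I. u i * M i j * u j))"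

text \<open>
  Cells are closed triangles, and \<^const>\<open>triangulation\<close> is the library notion of a finite
  conforming family of simplices.  The set \<open>\<Omega>\<close> may be taken open or closed; the condition on the
  interiors rules out domains from which part of the interior of a cell has been removed.
\<close>

definition triangulates :: "(real^2) set set \<Rightarrow> (real^2) set \<Rightarrow> bool" where
  "triangulates Th \<Omega> \<longleftrightarrow>
     triangulation Th \<and> (\<forall>T\<in>Th. 2 simplex T) \<and>
     \<Union>Th = closure \<Omega> \<and> (\<forall>T\<in>Th. interior T \<subseteq> \<Omega>)"

definition local_numbering :: "(real^2) set \<Rightarrow> (3 \<Rightarrow> real^2) \<Rightarrow> bool" where
  "local_numbering T p \<longleftrightarrow> bij_betw p UNIV {x. x extreme_point_of T}"

definition mesh_nodes :: "(real^2) set set \<Rightarrow> ((real^2) set \<Rightarrow> 3 \<Rightarrow> real^2) \<Rightarrow> (real^2) set" where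
  "mesh_nodes Th vert = (\<Union>T\<in>Th. range (vert T))"

definition free_nodes ::
  "(real^2) set set \<Rightarrow> ((real^2) set \<Rightarrow> 3 \<Rightarrow> real^2) \<Rightarrow> (real^2) set \<Rightarrow> (real^2) set" where
  "free_nodes Th vert \<Gamma>\<^sub>D = mesh_nodes Th vert - \<Gamma>\<^sub>D"

definition gradient :: "(real^2 \<Rightarrow> real) \<Rightarrow> real^2 \<Rightarrow> real^2" where
  "gradient f x = (THE D. GDERIV f x :> D)"

text \<open>
  The hat function of local vertex \<open>\<mu>\<close>, as an affine function on the whole plane; it is unique
  because the vertices \<open>p\<close> of a nondegenerate triangle are affinely independent.
\<close>

definition hat_function :: "(3 \<Rightarrow> real^2) \<Rightarrow> 3 \<Rightarrow> real^2 \<Rightarrow> real" where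
  "hat_function p \<mu> =
     (THE \<phi>. (\<exists>a b. \<forall>x. \<phi> x = a \<bullet> x + b) \<and> (\<forall>\<nu>. \<phi> (p \<nu>) = (if \<nu> = \<mu> then 1 else 0)))"

definition local_stiffness ::
  "(real^2 \<Rightarrow> real^2^2) \<Rightarrow> (3 \<Rightarrow> real^2) \<Rightarrow> (real^2) set \<Rightarrow> real^3^3" where
  "local_stiffness K\<^sub>m p T =
     (\<chi> \<mu> \<nu>. LINT x:T|lebesgue.
        (K\<^sub>m x *v gradient (hat_function p \<mu>) x) \<bullet> gradient (hat_function p \<nu>) x)"

definition piecewise_straight :: "(real^2) set \<Rightarrow> bool" where
  "piecewise_straight \<Gamma> \<longleftrightarrow>
     (\<exists>\<S>. finite \<S> \<and> (\<forall>S\<in>\<S>. \<exists>a b. S = closed_segment a b) \<and> \<Gamma> = \<Union>\<S>)"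

definition cut_cells :: "(real^2) set \<Rightarrow> (real^2) set set \<Rightarrow> (real^2) set set" where
  "cut_cells \<Gamma> Th = {T \<in> Th. \<Gamma> \<inter> interior T \<noteq> {}}"

definition opposite_edge :: "(3 \<Rightarrow> real^2) \<Rightarrow> 3 \<Rightarrow> (real^2) set" where
  "opposite_edge p \<mu> = convex hull (p ` (- {\<mu>}))"

text \<open>
  Vertex \<open>\<gamma>\<close> is separated by \<open>\<Gamma>\<close> from the other two: two vertices lie in the same component of
  \<open>T - \<Gamma>\<close> iff both or neither of them is \<open>\<gamma>\<close>.  The instance \<open>\<mu> = \<nu>\<close> says that no vertex lies
  on \<open>\<Gamma>\<close>.
\<close>

definition separates_vertex :: "(real^2) set \<Rightarrow> (real^2) set \<Rightarrow> (3 \<Rightarrow> real^2) \<Rightarrow> 3 \<Rightarrow> bool" where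
  "separates_vertex \<Gamma> T p \<gamma> \<longleftrightarrow>
     (\<forall>\<mu> \<nu>. connected_component (T - \<Gamma>) (p \<mu>) (p \<nu>) \<longleftrightarrow> (\<mu> = \<gamma> \<longleftrightarrow> \<nu> = \<gamma>))"

definition cut_by_chord :: "(real^2) set \<Rightarrow> (real^2) set \<Rightarrow> (3 \<Rightarrow> real^2) \<Rightarrow> bool" where
  "cut_by_chord \<Gamma> T p \<longleftrightarrow>
     (\<exists>\<mu> \<nu> a b. \<mu> \<noteq> \<nu> \<and> a \<in> opposite_edge p \<mu> \<and> b \<in> opposite_edge p \<nu> \<and>
        \<Gamma> \<inter> T = closed_segment a b) \<and>
     (\<exists>!\<gamma>. separates_vertex \<Gamma> T p \<gamma>)"

definition lone_vertex :: "(real^2) set \<Rightarrow> (real^2) set \<Rightarrow> (3 \<Rightarrow> real^2) \<Rightarrow> 3" where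
  "lone_vertex \<Gamma> T p = (THE \<gamma>. separates_vertex \<Gamma> T p \<gamma>)"

definition segment_length :: "(real^2) set \<Rightarrow> real" where
  "segment_length S = (THE l. \<exists>a b. S = closed_segment a b \<and> l = dist a b)"

lemma segment_length_closed_segment [simp]: "segment_length (closed_segment a b) = dist a b"
  unfolding segment_length_def
  by (rule the_equality) (auto simp: closed_segment_eq doubleton_eq_iff dist_commute)

definition chord_length :: "(real^2) set \<Rightarrow> (real^2) set \<Rightarrow> real" where
  "chord_length \<Gamma> T = segment_length (\<Gamma> \<inter> T)"

definition barrier_stiffness ::
  "(real^2 \<Rightarrow> real^2^2) \<Rightarrow> (real^2) set \<Rightarrow> real \<Rightarrow> (3 \<Rightarrow> real^2) \<Rightarrow> (real^2) set \<Rightarrow> real^3^3" where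
  "barrier_stiffness K\<^sub>m \<Gamma> R p T =
     (let K = local_stiffness K\<^sub>m p T;
          \<gamma> = lone_vertex \<Gamma> T p;
          v = K *v axis \<gamma> 1
      in K - ((columnvector v :: real^1^3) ** rowvector v) /\<^sub>R (K $ \<gamma> $ \<gamma> + chord_length \<Gamma> T / R))"

definition restrict_nodal :: "(3 \<Rightarrow> real^2) \<Rightarrow> (real^2 \<Rightarrow> real) \<Rightarrow> real^3" where
  "restrict_nodal p u = (\<chi> \<mu>. u (p \<mu>))"

text \<open>
  The entry \<open>(x, y)\<close> of the assembled matrix is the value of the bilinear form
  \<open>\<Sum>\<^sub>T u\<^sub>T\<^sup>T M\<^sub>T w\<^sub>T\<close> at the unit nodal vectors of \<open>x\<close> and \<open>y\<close>; the lemma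
  \<open>assemble_bilinear\<close> recovers the form from the entries.
\<close>

definition assemble ::
  "(real^2) set set \<Rightarrow> ((real^2) set \<Rightarrow> 3 \<Rightarrow> real^2) \<Rightarrow> ((real^2) set \<Rightarrow> real^3^3)
     \<Rightarrow> real^2 \<Rightarrow> real^2 \<Rightarrow> real" where
  "assemble Th vert M x y =
     (\<Sum>T\<in>Th. restrict_nodal (vert T) (indicator {x}) \<bullet>
        (M T *v restrict_nodal (vert T) (indicator {y})))"

lemma assemble_bilinear:
  assumes "finite Th"
  shows "(\<Sum>x\<in>mesh_nodes Th vert. \<Sum>y\<in>mesh_nodes Th vert. u x * assemble Th vert M x y * w y) =
         (\<Sum>T\<in>Th. restrict_nodal (vert T) u \<bullet> (M T *v restrict_nodal (vert T) w))"
proof -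
  let ?N = "mesh_nodes Th vert"
  have fin: "finite ?N"
    using assms by (simp add: mesh_nodes_def)
  have expand: "restrict_nodal (vert T) f = (\<Sum>x\<in>?N. f x *\<^sub>R restrict_nodal (vert T) (indicator {x}))"
    if "T \<in> Th" for T f
  proof -
    have "(\<Sum>x\<in>?N. f x * indicator {x} (vert T \<mu>)) = f (vert T \<mu>)" for \<mu>
    proof -
      have "vert T \<mu> \<in> ?N"
        using that by (auto simp: mesh_nodes_def)
      moreover have "(\<Sum>x\<in>?N. f x * indicator {x} (vert T \<mu>)) =
          (\<Sum>x\<in>?N. if vert T \<mu> = x then f x else 0)"
        by (intro sum.cong refl) (simp add: indicator_def)
      ultimately show ?thesis
        using fin by simp
    qed
    then show ?thesis
      by (subst vec_eq_iff) (simp add: restrict_nodal_def)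
  qed
  have "(\<Sum>T\<in>Th. restrict_nodal (vert T) u \<bullet> (M T *v restrict_nodal (vert T) w)) =
        (\<Sum>T\<in>Th. \<Sum>x\<in>?N. \<Sum>y\<in>?N. u x * (restrict_nodal (vert T) (indicator {x}) \<bullet>
           (M T *v restrict_nodal (vert T) (indicator {y}))) * w y)"
  proof (rule sum.cong[OF refl])
    fix T assume T: "T \<in> Th"
    show "restrict_nodal (vert T) u \<bullet> (M T *v restrict_nodal (vert T) w) =
        (\<Sum>x\<in>?N. \<Sum>y\<in>?N. u x * (restrict_nodal (vert T) (indicator {x}) \<bullet>
           (M T *v restrict_nodal (vert T) (indicator {y}))) * w y)"
      unfolding expand[OF T, of u] expand[OF T, of w]
      by (subst sum.swap) (simp add: inner_sum_left inner_sum_right linear_sum[OF matrix_vector_mul_linear]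
          matrix_vector_mult_scaleR algebra_simps sum_distrib_left)
  qed
  also have "\<dots> = (\<Sum>x\<in>?N. \<Sum>y\<in>?N. u x * assemble Th vert M x y * w y)"
    unfolding assemble_def sum_distrib_left sum_distrib_right
    by (subst sum.swap, rule sum.cong[OF refl], subst sum.swap, rule refl)
  finally show ?thesis ..
qed

end

theory Submission
  imports Defs
begin

text \<open>
  With \<open>v = K e\<^sub>\<gamma>\<close> and \<open>d = (K e\<^sub>\<gamma>) $ \<gamma> + s\<close>, \<open>s > 0\<close>, the form of the modified matrix at \<open>x\<close> is
  \<open>x \<bullet> K x - (v \<bullet> x)\<^sup>2 / d\<close>.  Since \<open>d\<close> strictly exceeds \<open>e\<^sub>\<gamma> \<bullet> K e\<^sub>\<gamma>\<close>, positivity of the form of \<open>K\<close> on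
  the line \<open>x - t e\<^sub>\<gamma>\<close> shows that this is nonnegative and vanishes only if \<open>v \<bullet> x = 0\<close>, and then
  \<open>x \<bullet> K x = 0\<close>.  For the stiffness matrix the latter forces \<open>x\<close> to be constant: the hat function
  gradients are constant on \<open>T\<close>, so \<open>x \<bullet> K x = g \<bullet> C g\<close> with \<open>C\<close> the (positive definite) integral of the
  permeability over \<open>T\<close> and \<open>g\<close> the gradient of the affine interpolant of \<open>x\<close>.  Globally, a nonzero
  nodal vector has positive energy in at least one cell, and the modification keeps it positive there.
\<close>

section \<open>Rank-one modification of a positive semidefinite matrix\<close>

lemma columnvector_times_rowvector_nth:
  fixes v w :: "real^'n"
  shows "((columnvector v :: real^1^'n) ** rowvector w) $ i $ j = v $ i * w $ j"
  by (simp add: matrix_matrix_mult_def columnvector_def rowvector_def sum_1)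

lemma rank_one_update_mult:
  fixes A :: "real^'n^'n" and v x :: "real^'n"
  shows "(A - ((columnvector v :: real^1^'n) ** rowvector v) /\<^sub>R d) *v x = A *v x - ((v \<bullet> x) / d) *\<^sub>R v"
  unfolding vec_eq_iff
  by (simp add: matrix_vector_mult_def columnvector_times_rowvector_nth inner_vec_def
      left_diff_distrib sum_subtractf sum_distrib_left sum_divide_distrib field_simps)

lemma symmetric_matrix_rank_one_update:
  fixes A :: "real^'n^'n"
  assumes "symmetric_matrix A"
  shows "symmetric_matrix (A - ((columnvector v :: real^1^'n) ** rowvector v) /\<^sub>R d)"
  using assms
  by (simp add: symmetric_matrix_def vec_eq_iff transpose_def columnvector_times_rowvector_nth
      mult.commute)

lemma symmetric_matrix_inner:
  fixes A :: "real^'n^'n"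
  assumes "symmetric_matrix A"
  shows "x \<bullet> (A *v y) = y \<bullet> (A *v x)"
  using assms by (metis dot_lmul_matrix inner_commute symmetric_matrix_def transpose_matrix_vector)

text \<open>Evaluate the form of \<open>A\<close> at \<open>x - (x \<bullet> A e / (e \<bullet> A e + s)) e\<close>, a shift by slightly less
  than the minimising multiple of \<open>e\<close>.\<close>

lemma rank_one_update_form_lower_bound:
  fixes A :: "real^'n^'n" and e x :: "real^'n"
  assumes sym: "symmetric_matrix A" and psd: "pos_semidef A" and s: "s > 0"
  defines "d \<equiv> e \<bullet> (A *v e) + s"
  shows "s * ((A *v e) \<bullet> x)\<^sup>2 / d\<^sup>2
    \<le> x \<bullet> ((A - ((columnvector (A *v e) :: real^1^'n) ** rowvector (A *v e)) /\<^sub>R d) *v x)"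
proof -
  define b where "b = (A *v e) \<bullet> x"
  define t where "t = b / d"
  have d: "d > 0"
    using psd s by (simp add: d_def pos_semidef_def add_nonneg_pos)
  have bx: "x \<bullet> (A *v e) = b" "e \<bullet> (A *v x) = b"
    using symmetric_matrix_inner[OF sym, of x e] by (simp_all add: b_def inner_commute)
  have "0 \<le> (x - t *\<^sub>R e) \<bullet> (A *v (x - t *\<^sub>R e))"
    using psd by (simp add: pos_semidef_def)
  also have "\<dots> = x \<bullet> (A *v x) - 2 * t * b + t\<^sup>2 * (d - s)"
    by (simp add: matrix_vector_mult_diff_distrib matrix_vector_mult_scaleR inner_diff_left
        inner_diff_right bx d_def power2_eq_square algebra_simps)
  \<comment> \<open>With \<open>t = b / d\<close> the terms -2tb + d t^2 collapse to -b^2/d, the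
    amount by which the modification lowers the form. The remaining -s t^2 is the slack kept in the
    lower bound.\<close>
  also have "\<dots> = x \<bullet> (A *v x) - b\<^sup>2 / d - s * b\<^sup>2 / d\<^sup>2"
    using d by (simp add: t_def field_simps power2_eq_square)
  finally show ?thesis
    by (simp add: rank_one_update_mult inner_diff_right bx b_def[symmetric] power2_eq_square)
qed

lemma pos_semidef_rank_one_update:
  fixes A :: "real^'n^'n" and e :: "real^'n"
  assumes "symmetric_matrix A" "pos_semidef A" "s > 0"
  shows "pos_semidef (A - ((columnvector (A *v e) :: real^1^'n) ** rowvector (A *v e))
    /\<^sub>R (e \<bullet> (A *v e) + s))"
  unfolding pos_semidef_def
  using rank_one_update_form_lower_bound[OF assms, of e] assms(3)
  by (meson divide_nonneg_nonneg mult_nonneg_nonneg less_imp_le order_trans zero_le_power2)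

text \<open>The slack in the lower bound forces the correction term to vanish, leaving the form of
  \<open>A\<close>. With \<open>s = 0\<close> this would fail: the vector \<open>e\<close> would
  have zero form even when \<open>e \<bullet> (A *v e)\<close> is positive.\<close>

lemma rank_one_update_form_eq_0:
  fixes A :: "real^'n^'n" and e x :: "real^'n"
  assumes "symmetric_matrix A" and psd: "pos_semidef A" and s: "s > 0"
    and zero: "x \<bullet> ((A - ((columnvector (A *v e) :: real^1^'n) ** rowvector (A *v e))
      /\<^sub>R (e \<bullet> (A *v e) + s)) *v x) = 0"
  shows "x \<bullet> (A *v x) = 0"
proof -
  have d: "e \<bullet> (A *v e) + s > 0"
    using psd s by (simp add: pos_semidef_def add_nonneg_pos)
  have "s * ((A *v e) \<bullet> x)\<^sup>2 / (e \<bullet> (A *v e) + s)\<^sup>2 \<le> 0"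
    using rank_one_update_form_lower_bound[OF assms(1-3), of e x] zero by simp
  then have "((A *v e) \<bullet> x)\<^sup>2 \<le> 0"
    using s d by (simp add: divide_le_0_iff mult_le_0_iff)
  then have "(A *v e) \<bullet> x = 0"
    by simp
  with zero show ?thesis
    by (simp add: rank_one_update_mult)
qed

section \<open>Affine functions, hat functions and their gradients\<close>

lemma affine_functions_eqI:
  fixes a a' :: "'a::euclidean_space"
  assumes hull: "affine hull S = UNIV" and eq: "\<And>x. x \<in> S \<Longrightarrow> a \<bullet> x + b = a' \<bullet> x + b'"
  shows "a = a' \<and> b = b'"
proof -
  \<comment> \<open>The agreement set of two affine functions is affine, so it contains the affine
    hull of \<open>S\<close>, the whole space. Evaluating at 0 and at \<open>a - a'\<close> then
    separates the constants from the slopes.\<close>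
  have "S \<subseteq> {x. (a - a') \<bullet> x = b' - b}"
    using eq by (force simp: inner_diff_left algebra_simps)
  then have "affine hull S \<subseteq> {x. (a - a') \<bullet> x = b' - b}"
    by (intro hull_minimal affine_hyperplane)
  then have *: "(a - a') \<bullet> x = b' - b" for x
    using hull by auto
  have "b = b'"
    using *[of 0] by simp
  moreover have "a = a'"
    using *[of "a - a'"] \<open>b = b'\<close> by simp
  ultimately show ?thesis
    by simp
qed

text \<open>With one point \<open>p\<close> of \<open>S\<close> as origin, the differences to the
  other points are linearly independent, so a linear functional can be prescribed on them. Its
  adjoint at 1 is the vector representing it as an inner product.\<close>

lemma affine_function_exists:
  fixes S :: "'a::euclidean_space set" and f :: "'a \<Rightarrow> real"
  assumes "\<not> affine_dependent S"
  shows "\<exists>a b. \<forall>x\<in>S. a \<bullet> x + b = f x"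
proof (cases "S = {}")
  case False
  then obtain p where p: "p \<in> S"
    by blast
  have "independent ((\<lambda>x. - p + x) ` (S - {p}))"
    using assms p affine_dependent_iff_dependent2 by blast
  then obtain g where g: "linear g" "\<forall>x\<in>(\<lambda>x. - p + x) ` (S - {p}). g x = f (p + x) - f p"
    using linear_independent_extend[of _ "\<lambda>x. f (p + x) - f p"] by blast
  have gx: "g x = adjoint g 1 \<bullet> x" for x
    using adjoint_works[OF g(1), of x 1] by (simp add: inner_commute)
  have "adjoint g 1 \<bullet> x + (f p - g p) = f x" if "x \<in> S" for x
  proof (cases "x = p")
    case False
    then have "g (- p + x) = f x - f p"
      using g(2) that by force
    then show ?thesis
      using linear_add[OF g(1), of "-p" x] linear_neg[OF g(1), of p] gx by simp
  qed (simp flip: gx)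
  then show ?thesis
    by blast
qed simp

text \<open>The extreme points of the hull of an affinely independent set are its generators, so
  \<open>p\<close> enumerates these. Three affinely independent points span the plane, which also
  gives a nonempty interior.\<close>

lemma simplex_local_numbering:
  assumes "2 simplex T" "local_numbering T p"
  shows "inj p" "\<not> affine_dependent (range p)" "affine hull (range p) = UNIV"
    "convex T" "interior T \<noteq> {}"
proof -
  obtain C where C: "\<not> affine_dependent C" "int (card C) = 3" "T = convex hull C"
    using assms(1) by (auto simp: simplex_def)
  have "{x. x extreme_point_of T} = C"
    using C by (auto simp: extreme_point_of_convex_hull_affine_independent)
  then have bij: "bij_betw p UNIV C"
    using assms(2) by (simp add: local_numbering_def)
  then have rp: "range p = C"
    by (simp add: bij_betw_def)
  show "inj p"
    using bij by (simp add: bij_betw_def)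
  show "\<not> affine_dependent (range p)"
    using C rp by simp
  show "affine hull (range p) = UNIV"
    using C rp by (simp add: affine_independent_span_eq)
  show "convex T"
    using C by simp
  show "interior T \<noteq> {}"
    using C interior_convex_hull_eq_empty[of C] by simp
qed

lemma gradient_affine: "gradient (\<lambda>x. a \<bullet> x + b) x = a"
proof -
  have *: "GDERIV (\<lambda>x. a \<bullet> x + b) x :> a"
    unfolding gderiv_def by (auto intro!: derivative_eq_intros simp: inner_commute)
  moreover have "D = a" if "GDERIV (\<lambda>x. a \<bullet> x + b) x :> D" for D
    using has_derivative_unique[OF that[unfolded gderiv_def] *[unfolded gderiv_def]]
    by (metis vector_eq_rdot inner_commute)
  ultimately show ?thesis
    unfolding gradient_def by (rule the_equality)
qed

text \<open>Resolves the definite description: affine independence of the vertices gives existence,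
  and their spanning the plane gives uniqueness.\<close>

lemma hat_function_affine:
  assumes "inj p" "\<not> affine_dependent (range p)" "affine hull (range p) = UNIV"
  obtains a b where "\<And>\<mu>. hat_function p \<mu> = (\<lambda>x. a \<mu> \<bullet> x + b \<mu>)"
    "\<And>\<mu> \<nu>. a \<mu> \<bullet> p \<nu> + b \<mu> = (if \<nu> = \<mu> then 1 else 0)"
proof -
  have "\<exists>a b. hat_function p \<mu> = (\<lambda>x. a \<bullet> x + b) \<and> (\<forall>\<nu>. a \<bullet> p \<nu> + b = (if \<nu> = \<mu> then 1 else 0))" for \<mu>
  proof -
    obtain a b where "\<forall>x\<in>range p. a \<bullet> x + b = (if x = p \<mu> then 1 else 0)"
      using affine_function_exists[OF assms(2), of "\<lambda>x. if x = p \<mu> then 1 else 0"] by blast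
    then have ab: "a \<bullet> p \<nu> + b = (if \<nu> = \<mu> then 1 else 0)" for \<nu>
      using assms(1) by (auto simp: inj_eq)
    have "hat_function p \<mu> = (\<lambda>x. a \<bullet> x + b)"
      unfolding hat_function_def
    proof (rule the_equality)
      fix \<phi> assume "(\<exists>a b. \<forall>x. \<phi> x = a \<bullet> x + b) \<and> (\<forall>\<nu>. \<phi> (p \<nu>) = (if \<nu> = \<mu> then 1 else 0))"
      then obtain a' b' where \<phi>: "\<phi> = (\<lambda>x. a' \<bullet> x + b')" "\<And>\<nu>. a' \<bullet> p \<nu> + b' = (if \<nu> = \<mu> then 1 else 0)"
        by fastforce
      then have "a' = a \<and> b' = b"
        using ab by (intro affine_functions_eqI[OF assms(3)]) auto
      then show "\<phi> = (\<lambda>x. a \<bullet> x + b)"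
        using \<phi> by simp
    qed (use ab in auto)
    with ab show ?thesis
      by blast
  qed
  then show ?thesis
    using that by metis
qed

text \<open>The sum is the gradient of the affine interpolant of the nodal values \<open>x\<close>,
  and an affine function has zero gradient exactly when it is constant.\<close>

lemma hat_gradients_sum_eq_0_iff:
  fixes p :: "3 \<Rightarrow> real^2" and x :: "real^3"
  assumes hull: "affine hull (range p) = UNIV"
    and ab: "\<And>\<mu> \<nu>. a \<mu> \<bullet> p \<nu> + b \<mu> = (if \<nu> = \<mu> then 1 else 0)"
  shows "(\<Sum>\<mu>\<in>UNIV. x $ \<mu> *\<^sub>R a \<mu>) = 0 \<longleftrightarrow> (\<exists>c. x = c *\<^sub>R 1)"
proof -
  have val: "(\<Sum>\<mu>\<in>UNIV. x $ \<mu> *\<^sub>R a \<mu>) \<bullet> p \<nu> + (\<Sum>\<mu>\<in>UNIV. x $ \<mu> * b \<mu>) = x $ \<nu>" for \<nu>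
  proof -
    have "(\<Sum>\<mu>\<in>UNIV. x $ \<mu> *\<^sub>R a \<mu>) \<bullet> p \<nu> + (\<Sum>\<mu>\<in>UNIV. x $ \<mu> * b \<mu>)
        = (\<Sum>\<mu>\<in>UNIV. x $ \<mu> * (a \<mu> \<bullet> p \<nu> + b \<mu>))"
      by (simp add: inner_sum_left sum.distrib distrib_left)
    also have "\<dots> = x $ \<nu>"
      by (simp add: ab if_distrib cong: if_cong)
    finally show ?thesis .
  qed
  show ?thesis
  proof
    assume zero: "(\<Sum>\<mu>\<in>UNIV. x $ \<mu> *\<^sub>R a \<mu>) = 0"
    define c where "c = (\<Sum>\<mu>\<in>UNIV. x $ \<mu> * b \<mu>)"
    have "x $ \<nu> = c" for \<nu>
      using val[of \<nu>] unfolding zero c_def[symmetric] by simp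
    then have "x = c *\<^sub>R 1"
      by (simp add: vec_eq_iff)
    then show "\<exists>c. x = c *\<^sub>R 1" ..
  next
    assume "\<exists>c. x = c *\<^sub>R 1"
    then obtain c where c: "x = c *\<^sub>R 1" ..
    \<comment> \<open>The interpolant and the constant function \<open>c\<close> agree at the
      vertices, so uniqueness identifies their gradients.\<close>
    have "(\<Sum>\<mu>\<in>UNIV. x $ \<mu> *\<^sub>R a \<mu>) = 0 \<and> (\<Sum>\<mu>\<in>UNIV. x $ \<mu> * b \<mu>) = c"
    proof (rule affine_functions_eqI[OF hull])
      fix y assume "y \<in> range p"
      then obtain \<nu> where "y = p \<nu>"
        by blast
      then show "(\<Sum>\<mu>\<in>UNIV. x $ \<mu> *\<^sub>R a \<mu>) \<bullet> y + (\<Sum>\<mu>\<in>UNIV. x $ \<mu> * b \<mu>) = 0 \<bullet> y + c"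
        using val[of \<nu>] by (simp only: c inner_zero_left) simp
    qed
    then show "(\<Sum>\<mu>\<in>UNIV. x $ \<mu> *\<^sub>R a \<mu>) = 0" ..
  qed
qed

section \<open>The integral of the permeability over a cell\<close>

definition integral_matrix :: "(real^'n \<Rightarrow> real^'m^'k) \<Rightarrow> (real^'n) set \<Rightarrow> real^'m^'k" where
  "integral_matrix K T = (\<chi> i j. LINT x:T|lebesgue. K x $ i $ j)"

text \<open>Since \<open>a\<close> and \<open>b\<close> do not vary with the point, the integrand is
  a finite linear combination of the entries of \<open>K\<close>.\<close>

lemma integral_matrix_bilinear:
  fixes K :: "real^'n \<Rightarrow> real^'m^'k"
  assumes int: "\<forall>i j. set_integrable lebesgue T (\<lambda>x. K x $ i $ j)"
  shows "set_integrable lebesgue T (\<lambda>x. (K x *v a) \<bullet> b)"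
    and "(LINT x:T|lebesgue. (K x *v a) \<bullet> b) = (integral_matrix K T *v a) \<bullet> b"
proof -
  have eq: "(A *v a) \<bullet> b = (\<Sum>i\<in>UNIV. \<Sum>j\<in>UNIV. A $ i $ j * (a $ j * b $ i))" for A :: "real^'m^'k"
    by (simp add: inner_vec_def matrix_vector_mult_def sum_distrib_right mult.assoc)
  have int': "set_integrable lebesgue T (\<lambda>x. K x $ i $ j * (a $ j * b $ i))" for i j
    using int by (intro set_integrable_mult_left) auto
  then have int2: "set_integrable lebesgue T (\<lambda>x. \<Sum>j\<in>UNIV. K x $ i $ j * (a $ j * b $ i))" for i
    unfolding set_integrable_def scaleR_sum_right by (intro Bochner_Integration.integrable_sum)
  show "set_integrable lebesgue T (\<lambda>x. (K x *v a) \<bullet> b)"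
    unfolding eq set_integrable_def scaleR_sum_right[of _ _ "UNIV :: 'k set"]
    by (intro Bochner_Integration.integrable_sum int2[unfolded set_integrable_def])
  show "(LINT x:T|lebesgue. (K x *v a) \<bullet> b) = (integral_matrix K T *v a) \<bullet> b"
    unfolding eq set_lebesgue_integral_def scaleR_sum_right
    using int' int2
    by (simp add: set_integrable_def Bochner_Integration.integral_sum scaleR_sum_right
        integral_matrix_def set_lebesgue_integral_def flip: mult.assoc)
qed

text \<open>The frontier of a convex set is null, so properties on the interior hold almost
  everywhere on \<open>T\<close>. Strict positivity survives integration because a nonempty open set
  is not null.\<close>

lemma integral_matrix_sym_pos_def:
  fixes K :: "real^'n \<Rightarrow> real^'m^'m"
  assumes int: "\<forall>i j. set_integrable lebesgue T (\<lambda>x. K x $ i $ j)"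
    and "convex T" "interior T \<noteq> {}"
    and spd: "\<forall>x\<in>interior T. symmetric_matrix (K x) \<and> pos_def (K x)"
  shows "symmetric_matrix (integral_matrix K T)" "pos_def (integral_matrix K T)"
proof -
  have "frontier T \<in> null_sets lebesgue"
    using negligible_convex_frontier[OF \<open>convex T\<close>] by (simp add: negligible_iff_null_sets)
  \<comment> \<open>Nothing is assumed about \<open>K\<close> on the boundary of a cell, which need not lie in the domain.\<close>
  then have AE_int: "AE x in lebesgue. x \<in> T \<longrightarrow> x \<in> interior T"
    by (rule AE_I') (use closure_subset[of T] in \<open>auto simp: frontier_def\<close>)
  have "(LINT x:T|lebesgue. K x $ i $ j) = (LINT x:T|lebesgue. K x $ j $ i)" for i j
    unfolding set_lebesgue_integral_def
  proof (rule integral_cong_AE)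
    show "AE x in lebesgue. indicator T x *\<^sub>R K x $ i $ j = indicator T x *\<^sub>R K x $ j $ i"
      using AE_int
    proof eventually_elim
      case (elim x)
      then show ?case
        using spd by (auto simp: indicator_def symmetric_matrix_def transpose_def vec_eq_iff)
    qed
  qed (use int in \<open>auto simp: set_integrable_def\<close>)
  then show "symmetric_matrix (integral_matrix K T)"
    by (simp add: symmetric_matrix_def integral_matrix_def transpose_def vec_eq_iff)
  show "pos_def (integral_matrix K T)"
    unfolding pos_def_def
  proof (intro allI impI)
    fix a :: "real^'m" assume a: "a \<noteq> 0"
    define f where "f = (\<lambda>x. indicator T x *\<^sub>R ((K x *v a) \<bullet> a))"
    have pos: "f x > 0" if "x \<in> interior T" for x
      using that spd a interior_subset[of T]
      by (auto simp: f_def pos_def_def inner_commute)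
    have nonneg: "AE x in lebesgue. 0 \<le> f x"
      using AE_int
    proof eventually_elim
      case (elim x)
      then show ?case
        using pos[of x] by (cases "x \<in> T") (auto simp: f_def)
    qed
    have intf: "integrable lebesgue f"
      using integral_matrix_bilinear(1)[OF int, of a a] unfolding set_integrable_def f_def .
    have "integral\<^sup>L lebesgue f \<noteq> 0"
    proof
      assume "integral\<^sup>L lebesgue f = 0"
      then have "AE x in lebesgue. f x = 0"
        using integral_nonneg_eq_0_iff_AE[OF intf nonneg] by simp
      then have "AE x in lebesgue. x \<notin> interior T"
        by eventually_elim (use pos in force)
      then have "negligible (interior T)"
        by (simp add: negligible_iff_null_sets AE_iff_null_sets)
      then show False
        using open_not_negligible \<open>interior T \<noteq> {}\<close> by blast
    qed
    moreover have "integral\<^sup>L lebesgue f \<ge> 0"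
      by (rule integral_nonneg_AE[OF nonneg])
    ultimately show "0 < a \<bullet> (integral_matrix K T *v a)"
      using integral_matrix_bilinear(2)[OF int, of a a]
      by (simp add: set_lebesgue_integral_def f_def inner_commute)
  qed
qed

section \<open>Local stiffness matrices without and with the barrier\<close>

lemma local_stiffness_properties:
  assumes T: "2 simplex T" "local_numbering T p"
    and int: "\<forall>i j. set_integrable lebesgue T (\<lambda>x. K\<^sub>m x $ i $ j)"
    and spd: "\<forall>x\<in>interior T. symmetric_matrix (K\<^sub>m x) \<and> pos_def (K\<^sub>m x)"
  shows "symmetric_matrix (local_stiffness K\<^sub>m p T)"
    and "pos_semidef (local_stiffness K\<^sub>m p T)"
    and "x \<bullet> (local_stiffness K\<^sub>m p T *v x) = 0 \<longleftrightarrow> (\<exists>c. x = c *\<^sub>R 1)"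
    and "local_stiffness K\<^sub>m p T *v 1 = 0"
proof -
  note simplex = simplex_local_numbering[OF T]
  obtain a b where hat: "\<And>\<mu>. hat_function p \<mu> = (\<lambda>x. a \<mu> \<bullet> x + b \<mu>)"
    and ab: "\<And>\<mu> \<nu>. a \<mu> \<bullet> p \<nu> + b \<mu> = (if \<nu> = \<mu> then 1 else 0)"
    by (rule hat_function_affine[OF simplex(1-3)]) (rule that)
  define C where "C = integral_matrix K\<^sub>m T"
  define G where "G x = (\<Sum>\<mu>\<in>UNIV. x $ \<mu> *\<^sub>R a \<mu>)" for x :: "real^3"
  note G_eq_0 = hat_gradients_sum_eq_0_iff[OF simplex(3), of a b, OF ab, folded G_def]
  have C: "symmetric_matrix C" "pos_def C"
    unfolding C_def using integral_matrix_sym_pos_def[OF int simplex(4,5) spd] by auto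
  have K: "local_stiffness K\<^sub>m p T $ \<mu> $ \<nu> = (C *v a \<mu>) \<bullet> a \<nu>" for \<mu> \<nu>
    by (simp add: local_stiffness_def hat gradient_affine integral_matrix_bilinear(2)[OF int] C_def)
  show "symmetric_matrix (local_stiffness K\<^sub>m p T)"
    using symmetric_matrix_inner[OF C(1)]
    by (simp add: symmetric_matrix_def transpose_def vec_eq_iff K inner_commute)
  \<comment> \<open>The product depends on \<open>y\<close> only through the interpolant gradient
    \<open>G y\<close>, so both the energy and the action on constants can be read off from
    it.\<close>
  have Kx: "(local_stiffness K\<^sub>m p T *v y) $ \<mu> = (C *v a \<mu>) \<bullet> G y" for y \<mu>
    by (simp add: matrix_vector_mult_def[of "local_stiffness K\<^sub>m p T"] K G_def inner_sum_right mult.commute)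
  have form: "y \<bullet> (local_stiffness K\<^sub>m p T *v y) = G y \<bullet> (C *v G y)" for y
  proof -
    have "y \<bullet> (local_stiffness K\<^sub>m p T *v y) = (\<Sum>\<mu>\<in>UNIV. y $ \<mu> * (a \<mu> \<bullet> (C *v G y)))"
      using symmetric_matrix_inner[OF C(1)] by (simp add: inner_vec_def[of y] Kx inner_commute)
    then show ?thesis
      by (simp add: inner_sum_left G_def)
  qed
  show "pos_semidef (local_stiffness K\<^sub>m p T)"
    unfolding pos_semidef_def form
  proof
    show "0 \<le> G y \<bullet> (C *v G y)" for y
      using C(2) by (cases "G y = 0") (auto simp: pos_def_def intro: less_imp_le)
  qed
  show "x \<bullet> (local_stiffness K\<^sub>m p T *v x) = 0 \<longleftrightarrow> (\<exists>c. x = c *\<^sub>R 1)"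
    unfolding form G_eq_0[symmetric]
    using C(2) by (cases "G x = 0") (auto simp: pos_def_def dest: spec[of _ "G x"])
  have "G 1 = 0"
    unfolding G_eq_0 by (rule exI[of _ 1]) simp
  then show "local_stiffness K\<^sub>m p T *v 1 = 0"
    by (simp add: vec_eq_iff[of "_ *v _"] Kx)
qed

text \<open>Gives the matrix the shape of the general rank-one lemmas: the diagonal entry at the
  lone vertex becomes \<open>e \<bullet> (K *v e)\<close>, and
  \<open>chord_length \<Gamma> T / R\<close> is the shift \<open>s\<close>.\<close>

lemma barrier_stiffness_rank_one_update:
  fixes p :: "3 \<Rightarrow> real^2" and T \<Gamma> :: "(real^2) set"
    and K\<^sub>m :: "real^2 \<Rightarrow> real^2^2"
  defines "e \<equiv> axis (lone_vertex \<Gamma> T p) 1"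
  defines "K \<equiv> local_stiffness K\<^sub>m p T"
  shows "barrier_stiffness K\<^sub>m \<Gamma> R p T =
    K - ((columnvector (K *v e) :: real^1^3) ** rowvector (K *v e)) /\<^sub>R (e \<bullet> (K *v e) + chord_length \<Gamma> T / R)"
  by (simp add: barrier_stiffness_def Let_def K_def e_def inner_axis' matrix_vector_mult_basis column_def)

lemma barrier_stiffness_properties:
  assumes T: "2 simplex T" "local_numbering T p"
    and int: "\<forall>i j. set_integrable lebesgue T (\<lambda>x. K\<^sub>m x $ i $ j)"
    and spd: "\<forall>x\<in>interior T. symmetric_matrix (K\<^sub>m x) \<and> pos_def (K\<^sub>m x)"
    and R: "chord_length \<Gamma> T / R > 0"
  shows "symmetric_matrix (barrier_stiffness K\<^sub>m \<Gamma> R p T)"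
    and "pos_semidef (barrier_stiffness K\<^sub>m \<Gamma> R p T)"
    and "x \<bullet> (barrier_stiffness K\<^sub>m \<Gamma> R p T *v x) = 0 \<Longrightarrow> x \<bullet> (local_stiffness K\<^sub>m p T *v x) = 0"
    and "{x. barrier_stiffness K\<^sub>m \<Gamma> R p T *v x = 0} = {c *\<^sub>R (1 :: real^3) | c. True}"
proof -
  note K = local_stiffness_properties[OF T int spd]
  note eq = barrier_stiffness_rank_one_update[of K\<^sub>m \<Gamma> R p T]
  show "symmetric_matrix (barrier_stiffness K\<^sub>m \<Gamma> R p T)"
    unfolding eq by (rule symmetric_matrix_rank_one_update[OF K(1)])
  show "pos_semidef (barrier_stiffness K\<^sub>m \<Gamma> R p T)"
    unfolding eq by (rule pos_semidef_rank_one_update[OF K(1,2) R])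
  show zero: "x \<bullet> (local_stiffness K\<^sub>m p T *v x) = 0" if "x \<bullet> (barrier_stiffness K\<^sub>m \<Gamma> R p T *v x) = 0" for x
    using that unfolding eq by (rule rank_one_update_form_eq_0[OF K(1,2) R])
  \<comment> \<open>By symmetry the inner product of \<open>K *v e\<close> with 1 is that of
    \<open>e\<close> with \<open>K *v 1\<close>, which is 0. Hence the correction vanishes on
    constants.\<close>
  have "barrier_stiffness K\<^sub>m \<Gamma> R p T *v (c *\<^sub>R 1) = 0" for c
    using symmetric_matrix_inner[OF K(1), of 1] K(4)
    by (simp add: eq rank_one_update_mult matrix_vector_mult_scaleR inner_commute)
  \<comment> \<open>A kernel vector has zero form, hence zero energy under the unmodified matrix,
    whose zero-energy vectors are the constants.\<close>
  moreover have "\<exists>c. x = c *\<^sub>R 1" if "barrier_stiffness K\<^sub>m \<Gamma> R p T *v x = 0" for x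
    using zero[of x] that by (simp add: K(3))
  ultimately show "{x. barrier_stiffness K\<^sub>m \<Gamma> R p T *v x = 0} = {c *\<^sub>R (1 :: real^3) | c. True}"
    by auto
qed

section \<open>Passage to the assembled global matrix\<close>

lemma assemble_symmetric:
  assumes "\<And>T. T \<in> Th \<Longrightarrow> symmetric_matrix (M T)"
  shows "assemble Th vert M x y = assemble Th vert M y x"
  unfolding assemble_def by (intro sum.cong refl symmetric_matrix_inner assms)

text \<open>Nodes outside \<open>I\<close> contribute nothing, so the form of the principal
  submatrix becomes a sum of cell energies.\<close>

lemma assemble_form_on_subset:
  assumes fin: "finite Th" and sub: "I \<subseteq> mesh_nodes Th vert" and u: "\<And>i. i \<notin> I \<Longrightarrow> u i = 0"
  shows "(\<Sum>x\<in>I. \<Sum>y\<in>I. u x * assemble Th vert M x y * u y)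
    = (\<Sum>T\<in>Th. restrict_nodal (vert T) u \<bullet> (M T *v restrict_nodal (vert T) u))"
proof -
  have fN: "finite (mesh_nodes Th vert)"
    using fin by (simp add: mesh_nodes_def)
  have "(\<Sum>x\<in>I. \<Sum>y\<in>I. u x * assemble Th vert M x y * u y)
    = (\<Sum>x\<in>mesh_nodes Th vert. \<Sum>y\<in>mesh_nodes Th vert. u x * assemble Th vert M x y * u y)"
    using u by (intro sum.mono_neutral_cong_left fN sub) auto
  then show ?thesis
    by (simp add: assemble_bilinear[OF fin])
qed

text \<open>Positive total energy for \<open>M\<close> needs a cell with nonzero \<open>M\<close>
  energy. There \<open>null\<close>, read contrapositively, makes the \<open>N\<close> energy
  nonzero, and semidefiniteness keeps other cells from cancelling it.\<close>

lemma sym_pos_def_on_assemble: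
  assumes fin: "finite Th" and sub: "I \<subseteq> mesh_nodes Th vert"
    and sym: "\<And>T. T \<in> Th \<Longrightarrow> symmetric_matrix (N T)"
    and psd: "\<And>T. T \<in> Th \<Longrightarrow> pos_semidef (N T)"
    and null: "\<And>T x. T \<in> Th \<Longrightarrow> x \<bullet> (N T *v x) = 0 \<Longrightarrow> x \<bullet> (M T *v x) = 0"
    and M: "sym_pos_def_on I (assemble Th vert M)"
  shows "sym_pos_def_on I (assemble Th vert N)"
  unfolding sym_pos_def_on_def
proof (intro conjI ballI allI impI)
  show "assemble Th vert N i j = assemble Th vert N j i" for i j
    by (rule assemble_symmetric[OF sym])
  fix u :: "real^2 \<Rightarrow> real" assume nz: "\<exists>i\<in>I. u i \<noteq> 0"
  \<comment> \<open>Cell energies see every vertex, including those outside \<open>I\<close> where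
    \<open>u\<close> is arbitrary, so \<open>u\<close> is replaced by its restriction to
    \<open>I\<close> extended by zero.\<close>
  define w where "w i = (if i \<in> I then u i else 0)" for i
  let ?q = "\<lambda>M T. restrict_nodal (vert T) w \<bullet> (M T *v restrict_nodal (vert T) w)"
  have form: "(\<Sum>i\<in>I. \<Sum>j\<in>I. u i * assemble Th vert M i j * u j) = (\<Sum>T\<in>Th. ?q M T)" for M
    by (subst assemble_form_on_subset[OF fin sub, symmetric]) (simp_all add: w_def)
  have "(\<Sum>T\<in>Th. ?q M T) > 0"
    using M nz by (simp add: sym_pos_def_on_def flip: form)
  then have "\<exists>T\<in>Th. ?q M T \<noteq> 0"
    by (metis (no_types, lifting) less_irrefl sum.neutral)
  then obtain T where T: "T \<in> Th" "?q N T \<noteq> 0"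
    using null by blast
  have nonneg: "?q N T \<ge> 0" if "T \<in> Th" for T
    using psd[OF that] by (simp add: pos_semidef_def)
  have "(\<Sum>T\<in>Th. ?q N T) > 0"
    using T nonneg by (intro sum_pos2[OF fin T(1)]) (auto simp: less_le)
  then show "0 < (\<Sum>i\<in>I. \<Sum>j\<in>I. u i * assemble Th vert N i j * u j)"
    by (simp add: form)
qed

theorem proposition3p1:
  fixes \<Omega> \<Gamma> \<Gamma>\<^sub>D \<Gamma>\<^sub>N :: "(real^2) set"
    and K\<^sub>m :: "real^2 \<Rightarrow> real^2^2"
    and Th :: "(real^2) set set"
    and vert :: "(real^2) set \<Rightarrow> 3 \<Rightarrow> real^2"
    and R :: real
  assumes "\<Gamma>\<^sub>D \<subseteq> frontier \<Omega>" and "\<Gamma>\<^sub>N = frontier \<Omega> - \<Gamma>\<^sub>D"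
    and "triangulates Th \<Omega>"
    and "\<forall>T\<in>Th. local_numbering T (vert T)"
    and "\<forall>x\<in>\<Omega>. symmetric_matrix (K\<^sub>m x) \<and> pos_def (K\<^sub>m x)"
    and "\<forall>T\<in>Th. \<forall>i j. set_integrable lebesgue T (\<lambda>x. K\<^sub>m x $ i $ j)"
    and "piecewise_straight \<Gamma>" and "\<Gamma> \<subseteq> \<Omega>"
    and "\<forall>T\<in>cut_cells \<Gamma> Th. cut_by_chord \<Gamma> T (vert T)"
    and "R > 0"
    and "\<forall>T\<in>cut_cells \<Gamma> Th. chord_length \<Gamma> T > 0"
  shows "(\<forall>T\<in>cut_cells \<Gamma> Th.
            symmetric_matrix (barrier_stiffness K\<^sub>m \<Gamma> R (vert T) T) \<and>
            pos_semidef (barrier_stiffness K\<^sub>m \<Gamma> R (vert T) T) \<and>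
            {x. barrier_stiffness K\<^sub>m \<Gamma> R (vert T) T *v x = 0} = {c *\<^sub>R (1 :: real^3) | c. True}) \<and>
         (sym_pos_def_on (free_nodes Th vert \<Gamma>\<^sub>D)
            (assemble Th vert (\<lambda>T. local_stiffness K\<^sub>m (vert T) T)) \<longrightarrow>
          sym_pos_def_on (free_nodes Th vert \<Gamma>\<^sub>D)
            (assemble Th vert (\<lambda>T. if T \<in> cut_cells \<Gamma> Th
               then barrier_stiffness K\<^sub>m \<Gamma> R (vert T) T
               else local_stiffness K\<^sub>m (vert T) T)))"
proof -
  have tri: "finite Th" "\<And>T. T \<in> Th \<Longrightarrow> 2 simplex T" "\<And>T. T \<in> Th \<Longrightarrow> interior T \<subseteq> \<Omega>"
    using assms(3) by (auto simp: triangulates_def triangulation_def)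
  have cut: "T \<in> Th" "chord_length \<Gamma> T / R > 0" if "T \<in> cut_cells \<Gamma> Th" for T
    using that assms(10,11) by (auto simp: cut_cells_def)
  \<comment> \<open>The inclusion of cell interiors in \<open>\<Omega>\<close> transfers the
    pointwise hypothesis on the permeability to each cell.\<close>
  have cell: "2 simplex T" "local_numbering T (vert T)"
    "\<forall>i j. set_integrable lebesgue T (\<lambda>x. K\<^sub>m x $ i $ j)"
    "\<forall>x\<in>interior T. symmetric_matrix (K\<^sub>m x) \<and> pos_def (K\<^sub>m x)" if "T \<in> Th" for T
    using that tri assms(4-6) by blast+
  note K = local_stiffness_properties[OF cell]
  note B = barrier_stiffness_properties[OF cell[OF cut(1)] cut(2)]
  let ?N = "\<lambda>T. if T \<in> cut_cells \<Gamma> Th then barrier_stiffness K\<^sub>m \<Gamma> R (vert T) T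
    else local_stiffness K\<^sub>m (vert T) T"
  have "sym_pos_def_on (free_nodes Th vert \<Gamma>\<^sub>D) (assemble Th vert ?N)"
    if "sym_pos_def_on (free_nodes Th vert \<Gamma>\<^sub>D) (assemble Th vert (\<lambda>T. local_stiffness K\<^sub>m (vert T) T))"
  proof (rule sym_pos_def_on_assemble[OF tri(1) _ _ _ _ that])
    show "free_nodes Th vert \<Gamma>\<^sub>D \<subseteq> mesh_nodes Th vert"
      by (auto simp: free_nodes_def)
    fix T assume T: "T \<in> Th"
    show "symmetric_matrix (?N T)" "pos_semidef (?N T)"
      using K(1,2)[OF T T T T] B(1,2) by auto
    show "x \<bullet> (local_stiffness K\<^sub>m (vert T) T *v x) = 0" if "x \<bullet> (?N T *v x) = 0" for x
      using that B(3) by (auto split: if_splits)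
  qed
  then show ?thesis
    using B(1,2,4) by blast
qed

end
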